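(* If $F$ is a partially marked forest, then $\iota_{\rm g}(F)\le \iota_{\rm g}'(F)$.
   Context: All graphs are finite and simple; $N[x]$ is the closed neighborhood of $x$. A partially marked graph $G|A$ is a graph $G$ with a set $A\subseteq V(G)$ of marked vertices such that $G-A$ has no isolated vertices. The isolation game on $G|A$: Dominator and Staller alternately choose vertices. A marked set $M$ is maintained, initially $M=A$. A vertex $x$ may be chosen only if $N[x]\not\subseteq M$. When $x$ is chosen, $M$ is replaced by $M\cup N[x]\cup U$, where $U$ is the set of isolated vertices of $G-(M\cup N[x])$. The game ends when every vertex is marked. Dominator wants to minimize the number of chosen vertices, Staller to maximize it. $\iota_{\rm g}(G|A)$ (resp. $\iota_{\rm g}'(G|A)$) is the number of chosen vertices under optimal play when Dominator (resp. Staller) moves first. A partially marked forest is a partially marked graph whose underlying graph is a forest (with $A=\emptyset$ this is the ordinary isolation game on a forest, i.e. the game that ends when the unchosen-and-undominated vertices form an independent set). *)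

theory Defs
  imports "Graph_Theory.Digraph_Component"
begin

text \<open>
  Finite simple graphs are the locale \<^locale>\<open>graph\<close>: finite, loop-free, symmetric digraphs without
  parallel arcs.  Each undirected edge is a pair of opposite arcs.
\<close>

definition closed_nbhd :: "('a, 'b) pre_digraph \<Rightarrow> 'a \<Rightarrow> 'a set" where
  "closed_nbhd G x = insert x {y. x \<rightarrow>\<^bsub>G\<^esub> y}"

definition isolated_verts :: "('a, 'b) pre_digraph \<Rightarrow> 'a set" where
  "isolated_verts G = {v \<in> verts G. \<nexists>u. v \<rightarrow>\<^bsub>G\<^esub> u}"

definition delete_verts :: "('a, 'b) pre_digraph \<Rightarrow> 'a set \<Rightarrow> ('a, 'b) pre_digraph" where
  "delete_verts G S = G \<restriction> (verts G - S)"

text \<open>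
  The library constant \<^const>\<open>forest\<close> also excludes directed cycles of length 2, which every edge
  of a symmetric digraph forms; it therefore cannot be used here.  In a simple graph the undirected
  cycles are exactly the directed cycles of length at least 3.
\<close>

definition undirected_forest :: "('a, 'b) pre_digraph \<Rightarrow> bool" where
  "undirected_forest G \<longleftrightarrow> \<not> (\<exists>p. pre_digraph.cycle G p \<and> length p \<ge> 3)"

locale partially_marked_graph = graph G for G :: "('a, 'b) pre_digraph" (structure) +
  fixes A :: "'a set"
  assumes marked_subset: "A \<subseteq> verts G"
    and no_isolated: "isolated_verts (delete_verts G A) = {}"

locale partially_marked_forest = partially_marked_graph +
  assumes undirected_forest: "undirected_forest G"

datatype player = Dominator | Staller

context graph
begin

definition legal_moves :: "'a set \<Rightarrow> 'a set" where
  "legal_moves M = {x \<in> verts G. \<not> closed_nbhd G x \<subseteq> M}"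

definition mark :: "'a set \<Rightarrow> 'a \<Rightarrow> 'a set" where
  "mark M x = M \<union> closed_nbhd G x \<union> isolated_verts (delete_verts G (M \<union> closed_nbhd G x))"

lemma closed_nbhd_subset: "x \<in> verts G \<Longrightarrow> closed_nbhd G x \<subseteq> verts G"
  by (auto simp: closed_nbhd_def)

lemma finite_legal_moves: "finite (legal_moves M)"
  by (simp add: legal_moves_def)

lemma legal_moves_nonempty: "\<not> verts G \<subseteq> M \<Longrightarrow> legal_moves M \<noteq> {}"
  by (auto simp: legal_moves_def closed_nbhd_def)

lemma mark_decreases:
  assumes "x \<in> legal_moves M"
  shows "card (verts G - mark M x) < card (verts G - M)"
proof (rule psubset_card_mono)
  have "closed_nbhd G x \<subseteq> verts G" "\<not> closed_nbhd G x \<subseteq> M"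
    using assms closed_nbhd_subset by (auto simp: legal_moves_def)
  then show "verts G - mark M x \<subset> verts G - M"
    by (auto simp: mark_def)
qed simp

text \<open>
  The number of vertices chosen under optimal play from the position with marked set \<open>M\<close> in which
  \<open>p\<close> is to move.
\<close>

function game_value :: "player \<Rightarrow> 'a set \<Rightarrow> nat" where
  "game_value p M =
    (if verts G \<subseteq> M then 0
     else case p of
       Dominator \<Rightarrow> Suc (Min ((\<lambda>x. game_value Staller (mark M x)) ` legal_moves M))
     | Staller \<Rightarrow> Suc (Max ((\<lambda>x. game_value Dominator (mark M x)) ` legal_moves M)))"
  by pat_completeness auto
termination
  by (relation "measure (\<lambda>(p, M). card (verts G - M))") (auto simp: mark_decreases)

declare game_value.simps [simp del]

definition game_isolation_number :: "'a set \<Rightarrow> nat" where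
  "game_isolation_number A = game_value Dominator A"

definition game_isolation_number' :: "'a set \<Rightarrow> nat" where
  "game_isolation_number' A = game_value Staller A"

end

end

theory Submission
  imports Defs
begin

text \<open>
  Take a longest path among those that end in an unmarked vertex, and let \<open>p\<close>, \<open>u\<close>, \<open>v\<close> be its last
  three vertices.  Dominator opens with \<open>p\<close> and from then on compares the real game with an imagined
  game in which \<open>p\<close> was not played and Staller starts.  By maximality of the path, every move that
  would mark \<open>v\<close> in the imagined game marks nothing new in the real one.  So Staller can never mark
  \<open>v\<close> in the imagined game, whereas as soon as Dominator's imagined optimal move is illegal in the
  real game (in particular when it marks \<open>v\<close>), it is a wasted move that makes up for the opening
  move \<open>p\<close>, and the argument can be repeated from the current real position.
\<close>

context graph
begin

section \<open>Saturated positions and single moves\<close>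

definition saturated :: "'a set \<Rightarrow> bool" where
  "saturated M \<longleftrightarrow> (\<forall>v\<in>verts G - M. \<exists>u. v \<rightarrow> u \<and> u \<notin> M)"

lemma adj_sym: "u \<rightarrow> v \<Longrightarrow> v \<rightarrow> u"
  using sym_arcs by (rule arcs_ends_symmetric)

lemma isolated_verts_delete_verts:
  "isolated_verts (delete_verts G S) = {v \<in> verts G - S. \<forall>u. v \<rightarrow> u \<longrightarrow> u \<in> S}"
proof -
  have "v \<rightarrow>\<^bsub>G \<restriction> (verts G - S)\<^esub> u \<longleftrightarrow> v \<rightarrow> u \<and> v \<notin> S \<and> u \<notin> S" for u v
    by (auto simp: arcs_ends_conv induce_subgraph_def intro: rev_image_eqI)
  then show ?thesis
    by (auto simp: isolated_verts_def delete_verts_def)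
qed

lemma mark_eq:
  "mark M x = M \<union> closed_nbhd G x \<union> {v \<in> verts G. \<forall>u. v \<rightarrow> u \<longrightarrow> u \<in> M \<union> closed_nbhd G x}"
  by (auto simp: mark_def isolated_verts_delete_verts)

lemma subset_mark: "M \<subseteq> mark M x"
  by (auto simp: mark_eq)

lemma mark_mono: "M \<subseteq> M' \<Longrightarrow> mark M x \<subseteq> mark M' x"
  by (auto simp: mark_eq)

text \<open>One round of marking isolated vertices suffices: a vertex marked for being isolated has
  all its neighbours in \<open>M \<union> closed_nbhd G x\<close>, so no remaining vertex loses an
  unmarked neighbour.\<close>

lemma saturated_mark: "saturated (mark M x)"
  unfolding saturated_def
proof
  fix v assume v: "v \<in> verts G - mark M x"
  then obtain u where u: "v \<rightarrow> u" "u \<notin> M \<union> closed_nbhd G x"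
    by (auto simp: mark_eq)
  moreover have "v \<notin> M \<union> closed_nbhd G x"
    using v by (auto simp: mark_eq)
  ultimately have "u \<notin> mark M x"
    using adj_sym[OF u(1)] by (auto simp: mark_eq)
  with u show "\<exists>u. v \<rightarrow> u \<and> u \<notin> mark M x" by blast
qed

lemma saturated_mark_illegal:
  "saturated M \<Longrightarrow> closed_nbhd G x \<subseteq> M \<Longrightarrow> mark M x = M"
  unfolding saturated_def mark_eq by blast

text \<open>An illegal move leaves a saturated position unchanged, and marking is monotone. So a
  move of the smaller position is wasted once the larger one forbids it.\<close>

lemma mark_illegal_subset:
  assumes "M \<subseteq> M'" "saturated M'" "x \<in> verts G" "x \<notin> legal_moves M'"
  shows "mark M x \<subseteq> M'"
  using mark_mono[OF assms(1), of x] saturated_mark_illegal[OF assms(2), of x] assms(3,4)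
  by (auto simp: legal_moves_def)

lemma legal_moves_antimono: "M \<subseteq> M' \<Longrightarrow> legal_moves M' \<subseteq> legal_moves M"
  by (auto simp: legal_moves_def)

lemma legal_moves_imp_unmarked: "x \<in> legal_moves M \<Longrightarrow> \<not> verts G \<subseteq> M"
  using closed_nbhd_subset by (auto simp: legal_moves_def)

section \<open>Optimal play and the continuation principle\<close>

lemma game_value_marked: "verts G \<subseteq> M \<Longrightarrow> game_value p M = 0"
  by (subst game_value.simps) simp

lemma game_value_Dominator_le:
  assumes "x \<in> legal_moves M"
  shows "game_value Dominator M \<le> Suc (game_value Staller (mark M x))"
  using legal_moves_imp_unmarked[OF assms] assms finite_legal_moves
  by (subst game_value.simps) auto

lemma game_value_Staller_ge:
  assumes "x \<in> legal_moves M"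
  shows "Suc (game_value Dominator (mark M x)) \<le> game_value Staller M"
  using legal_moves_imp_unmarked[OF assms] assms finite_legal_moves
  by (subst (2) game_value.simps) auto

lemma game_value_Dominator_attained:
  assumes "\<not> verts G \<subseteq> M"
  obtains x where "x \<in> legal_moves M"
    "game_value Dominator M = Suc (game_value Staller (mark M x))"
proof -
  let ?V = "(\<lambda>x. game_value Staller (mark M x)) ` legal_moves M"
  have "Min ?V \<in> ?V"
    using finite_legal_moves legal_moves_nonempty[OF assms] by (intro Min_in) auto
  moreover have "game_value Dominator M = Suc (Min ?V)"
    using assms by (subst game_value.simps) simp
  ultimately show thesis using that by auto
qed

lemma game_value_Staller_attained:
  assumes "\<not> verts G \<subseteq> M"
  obtains x where "x \<in> legal_moves M"
    "game_value Staller M = Suc (game_value Dominator (mark M x))"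
proof -
  let ?V = "(\<lambda>x. game_value Dominator (mark M x)) ` legal_moves M"
  have "Max ?V \<in> ?V"
    using finite_legal_moves legal_moves_nonempty[OF assms] by (intro Max_in) auto
  moreover have "game_value Staller M = Suc (Max ?V)"
    using assms by (subst game_value.simps) simp
  ultimately show thesis using that by auto
qed

lemma continuation_principle:
  "M \<subseteq> M' \<Longrightarrow> saturated M' \<Longrightarrow> game_value p M' \<le> game_value p M"
proof (induction "card (verts G - M)" arbitrary: M M' p rule: less_induct)
  case less
  have IH: "game_value q (mark M' y) \<le> game_value q (mark M x)"
    if "x \<in> legal_moves M" "mark M x \<subseteq> mark M' y" for q x y
    using less.hyps[OF mark_decreases[OF that(1)] that(2)] saturated_mark by blast
  show ?case
  proof (cases "verts G \<subseteq> M'")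
    case False
    then have M: "\<not> verts G \<subseteq> M" using less.prems by blast
    show ?thesis
    proof (cases p)
      case Dominator
      obtain x where x: "x \<in> legal_moves M"
        "game_value Dominator M = Suc (game_value Staller (mark M x))"
        using game_value_Dominator_attained[OF M] .
      obtain y where y: "y \<in> legal_moves M'" "mark M x \<subseteq> mark M' y"
      proof (cases "x \<in> legal_moves M'")
        case True
        then show thesis using that mark_mono[OF less.prems(1)] by blast
      next
        case illegal: False
        \<comment> \<open>Copying \<open>x\<close> would add nothing to \<open>M'\<close>, so any
          legal \<open>y\<close> keeps \<open>M'\<close> ahead.\<close>
        have "mark M x \<subseteq> M'"
          using mark_illegal_subset less.prems illegal x(1) by (auto simp: legal_moves_def)
        then show thesis
          using that legal_moves_nonempty[OF False] subset_mark by blast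
      qed
      show ?thesis
        using game_value_Dominator_le[OF y(1)] IH[OF x(1) y(2), of Staller] x(2) Dominator by simp
    next
      case Staller
      obtain x where x: "x \<in> legal_moves M'"
        "game_value Staller M' = Suc (game_value Dominator (mark M' x))"
        using game_value_Staller_attained[OF False] .
      have xM: "x \<in> legal_moves M"
        using x(1) legal_moves_antimono[OF less.prems(1)] by blast
      show ?thesis
        using game_value_Staller_ge[OF xM] IH[OF xM mark_mono[OF less.prems(1)], of Dominator]
          x(2) Staller by simp
    qed
  qed (simp add: game_value_marked)
qed

text \<open>
  The moves that can mark \<open>v\<close> from a position containing \<open>I\<close> are those marking \<open>v\<close> itself or an
  unmarked neighbour of \<open>v\<close>; all of them have to be illegal once \<open>R\<close> is marked.
\<close>

definition guarded :: "'a set \<Rightarrow> 'a \<Rightarrow> 'a set \<Rightarrow> bool" where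
  "guarded I v R \<longleftrightarrow>
    (\<forall>w\<in>closed_nbhd G v - I. \<forall>t\<in>verts G. w \<in> closed_nbhd G t \<longrightarrow> closed_nbhd G t \<subseteq> R)"

lemma guarded_mono: "guarded I v R \<Longrightarrow> I \<subseteq> I' \<Longrightarrow> R \<subseteq> R' \<Longrightarrow> guarded I' v R'"
  unfolding guarded_def by blast

text \<open>By saturation \<open>v\<close> has an unmarked neighbour \<open>u\<close>. A move
  marking \<open>v\<close> has \<open>v\<close> in its closed neighbourhood, or isolates
  \<open>v\<close> and then has \<open>u\<close> in it; both lie in
  \<open>closed_nbhd G v - I\<close>.\<close>

lemma guarded_mark_illegal:
  assumes "guarded I v R" "saturated I" "v \<in> verts G - I" "v \<in> mark I t" "t \<in> verts G"
  shows "t \<notin> legal_moves R"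
proof -
  obtain u where "v \<rightarrow> u" "u \<notin> I"
    using assms(2,3) by (auto simp: saturated_def)
  then have "\<exists>w\<in>closed_nbhd G v - I. w \<in> closed_nbhd G t"
    using assms(3,4) by (auto simp: mark_eq closed_nbhd_def)
  then show ?thesis
    using assms(1,5) by (auto simp: guarded_def legal_moves_def)
qed

lemma guarded_imp_mem:
  "guarded I v R \<Longrightarrow> v \<in> verts G - I \<Longrightarrow> v \<in> R"
  by (auto simp: guarded_def closed_nbhd_def)

section \<open>Longest paths in forests\<close>

lemma apath_extend:
  assumes "undirected_forest G" "apath a p v" "v \<rightarrow> w" "p = [] \<or> w \<noteq> tail G (last p)"
  obtains e where "tail G e = v" "apath a (p @ [e]) w"
proof -
  obtain e where e: "e \<in> arcs G" "tail G e = v" "head G e = w"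
    using assms(3) by auto
  have p: "awalk a p v" "distinct (awalk_verts a p)"
    using assms(2) by (auto simp: apath_def)
  have "w \<noteq> v"
    using e no_loops[of e] by auto
  \<comment> \<open>Otherwise the segment \<open>r\<close> of the path from \<open>w\<close> to
    \<open>v\<close>, closed by \<open>e\<close>, would be an undirected cycle.\<close>
  have "w \<notin> set (awalk_verts a p)"
  proof
    assume "w \<in> set (awalk_verts a p)"
    then obtain q r where qr: "p = q @ r" "awalk a q w" "awalk w r v"
      using awalk_decomp[OF p(1)] by blast
    have "r \<noteq> []"
      using qr(3) \<open>w \<noteq> v\<close> by (auto simp: awalk_Nil_iff)
    \<comment> \<open>A single arc would make \<open>w\<close> the excluded predecessor of
      \<open>v\<close>; so \<open>r\<close> has at least two arcs, and \<open>e\<close> brings the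
      length to 3.\<close>
    moreover have "length r \<noteq> 1"
    proof
      assume "length r = 1"
      then obtain f where "r = [f]" by (auto simp: length_Suc_conv)
      then show False
        using qr assms(4) by (auto simp: awalk_Cons_iff)
    qed
    ultimately have len: "length (r @ [e]) \<ge> 3"
      by (cases r) (auto simp: Suc_le_eq)
    have r: "distinct (awalk_verts w r)"
      using p awalk_verts_append2[of a q r v] qr by simp
    have cyc: "awalk w (r @ [e]) w"
      using qr(3) e by (metis arc_implies_awalk awalk_appendI)
    have "awalk_verts w (r @ [e]) = awalk_verts w r @ [w]"
      using awalk_verts_append[OF cyc] e by simp
    moreover obtain xs where "awalk_verts w r = w # xs"
      using awhd_of_awalk[OF qr(3)] by (cases "awalk_verts w r") auto
    ultimately have "distinct (tl (awalk_verts w (r @ [e])))"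
      using r by simp
    with cyc len assms(1) show False
      unfolding undirected_forest_def cycle_def by blast
  qed
  moreover have "awalk a (p @ [e]) w"
    using p(1) e by (metis arc_implies_awalk awalk_appendI)
  ultimately have "apath a (p @ [e]) w"
    using p e by (auto simp: apath_def awalk_verts_append)
  with e that show thesis by blast
qed

text \<open>This supplies the opening move: \<open>x\<close> is the vertex called \<open>p\<close>
  in the outline, while \<open>p\<close> below is the whole path.\<close>

lemma guarded_move_exists:
  assumes "undirected_forest G" "saturated I" "\<not> verts G \<subseteq> I"
  obtains v x where "v \<in> verts G - I" "x \<in> verts G" "guarded I v (mark I x)"
proof -
  \<comment> \<open>Only the end must be unmarked, so that paths can be rerouted through marked
    vertices.\<close>
  define L where "L n \<longleftrightarrow> (\<exists>a p v. apath a p v \<and> v \<notin> I \<and> length p = n)" for n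
  obtain z where "z \<in> verts G" "z \<notin> I" using assms(3) by blast
  then have "L 0" by (auto simp: L_def apath_Nil_iff)
  moreover have "\<forall>n. L n \<longrightarrow> n \<le> card (verts G)"
    using length_apath by (auto simp: L_def)
  ultimately obtain n where n: "L n" "\<And>m. L m \<Longrightarrow> m \<le> n"
    using Nat.ex_has_greatest_nat[of L 0 "card (verts G)"] by blast
  obtain a p v where p: "apath a p v" "v \<notin> I" and "length p = n"
    using n(1) by (auto simp: L_def)
  then have max: "length p' \<le> length p" if "apath a' p' v'" "v' \<notin> I" for a' p' v'
    using n(2) that by (auto simp: L_def)
  \<comment> \<open>One more arc would beat the maximum, even if \<open>v'\<close> itself is
    marked.\<close>
  have no_ext: "w \<in> I"
    if p': "apath a' p' v'" "length p \<le> length p'" and w: "v' \<rightarrow> w" "p' = [] \<or> w \<noteq> tail G (last p')"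
    for a' p' v' w
  proof (rule ccontr)
    assume "w \<notin> I"
    moreover obtain e where "apath a' (p' @ [e]) w"
      using apath_extend[OF assms(1) p'(1) w] by blast
    ultimately show False using max[of a' "p' @ [e]" w] p'(2) by simp
  qed
  have v: "v \<in> verts G" using p by (auto simp: apath_def)
  then obtain u' where u': "v \<rightarrow> u'" "u' \<notin> I"
    using assms(2) p by (auto simp: saturated_def)
  \<comment> \<open>\<open>u'\<close> is unmarked yet cannot extend the path, so it is the
    predecessor of \<open>v\<close>.\<close>
  have "p \<noteq> []" and u'_last: "u' = tail G (last p)"
    using no_ext[OF p(1) order_refl u'(1)] u'(2) by blast+
  then obtain q e where qe: "p = q @ [e]" by (metis append_butlast_last_id)
  define u where "u = tail G e"
  have u: "v \<rightarrow> u" "u \<rightarrow> v" "u \<notin> I"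
    using u' u'_last adj_sym by (auto simp: u_def qe)
  have q: "apath a q u"
    using p(1) unfolding qe u_def apath_append_iff by (auto simp: apath_Cons_iff)
  have v_nbr: "w \<in> I" if "v \<rightarrow> w" "w \<noteq> u" for w
    using no_ext[OF p(1) order_refl that(1)] that(2) by (simp add: qe u_def)
  \<comment> \<open>\<open>p @ [f]\<close> is longer than \<open>p\<close>, so \<open>c\<close>
    reaches only marked vertices besides \<open>v\<close>.\<close>
  have v_nbr_nbr: "w \<in> I" if c: "v \<rightarrow> c" "c \<noteq> u" and w: "c \<rightarrow> w" "w \<noteq> v" for c w
  proof -
    obtain f where f: "tail G f = v" "apath a (p @ [f]) c"
      using apath_extend[OF assms(1) p(1) c(1)] c(2) by (auto simp: qe u_def)
    show ?thesis
      using no_ext[OF f(2) _ w(1)] w(2) f(1) by simp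
  qed
  \<comment> \<open>If the path has only the arc \<open>e\<close>, then \<open>u\<close> has no
    predecessor and Dominator plays \<open>u\<close> itself.\<close>
  define x where "x = (if q = [] then u else tail G (last q))"
  \<comment> \<open>\<open>q @ [f]\<close> is as long as \<open>p\<close>, so maximality restricts
    \<open>c\<close> as it restricts \<open>v\<close>.\<close>
  have u_nbr_nbr: "w \<in> I" if c: "u \<rightarrow> c" "c \<noteq> x" and w: "c \<rightarrow> w" "w \<noteq> u" for c w
  proof -
    have "q = [] \<or> c \<noteq> tail G (last q)"
      using c(2) by (auto simp: x_def)
    then obtain f where f: "tail G f = u" "apath a (q @ [f]) c"
      using apath_extend[OF assms(1) q c(1)] by blast
    show ?thesis
      using no_ext[OF f(2) _ w(1)] w(2) f(1) by (simp add: qe)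
  qed
  have x: "x = u \<or> x \<rightarrow> u"
  proof (cases "q = []")
    case False
    then obtain q' f where "q = q' @ [f]" by (metis append_butlast_last_id)
    then have "f \<in> arcs G" "tail G f = x" "head G f = u"
      using q by (auto simp: x_def apath_append_iff apath_simps)
    then show ?thesis
      using in_arcs_imp_in_arcs_ends[of f] by simp
  qed (simp add: x_def)
  then have xu: "u \<in> closed_nbhd G x" and "x \<in> verts G"
    using u(2) by (auto simp: closed_nbhd_def)
  \<comment> \<open>For \<open>c \<noteq> x\<close>, all neighbours of \<open>c\<close> except
    \<open>u\<close> are marked, so \<open>c\<close> is marked at the latest when \<open>u\<close>
    is.\<close>
  have u_nbr: "c \<in> mark I x" if "u \<rightarrow> c" for c
  proof (cases "c = x")
    case False
    then show ?thesis
      using u_nbr_nbr[OF that] that xu adj_in_verts by (auto simp: mark_eq)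
  qed (simp add: mark_eq closed_nbhd_def)
  have "closed_nbhd G t \<subseteq> mark I x"
    if w: "w \<in> closed_nbhd G v - I" and t: "t \<in> verts G" "w \<in> closed_nbhd G t" for w t
  proof -
    have vu: "u \<in> mark I x" "v \<in> mark I x"
      using xu u_nbr u(2) by (auto simp: mark_eq)
    have I: "I \<subseteq> mark I x" by (rule subset_mark)
    \<comment> \<open>By \<open>v_nbr\<close>, only \<open>u\<close> remains among the neighbours of
      \<open>v\<close>, so \<open>t\<close> is in the closed neighbourhood of \<open>v\<close> or
      \<open>u\<close>.\<close>
    consider "w = v" | "w = u"
      using w v_nbr by (auto simp: closed_nbhd_def)
    then consider "t = v" | "t = u" | "t = x" | "v \<rightarrow> t" "t \<noteq> u" | "u \<rightarrow> t" "t \<noteq> x"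
      using t adj_sym by (auto simp: closed_nbhd_def)
    then show ?thesis
    proof cases
      case 1
      then show ?thesis using v_nbr vu I by (auto simp: closed_nbhd_def)
    next
      case 2
      then show ?thesis using u_nbr vu by (auto simp: closed_nbhd_def)
    next
      case 3
      then show ?thesis by (auto simp: mark_eq)
    next
      case 4
      then show ?thesis using v_nbr v_nbr_nbr vu I by (fastforce simp: closed_nbhd_def)
    next
      case 5
      then show ?thesis using u_nbr u_nbr_nbr vu I by (fastforce simp: closed_nbhd_def)
    qed
  qed
  then have "guarded I v (mark I x)"
    by (auto simp: guarded_def)
  with that v p(2) \<open>x \<in> verts G\<close> show thesis by blast
qed

section \<open>Comparison of the real and the imagined game\<close>

lemma forest_game_values:
  assumes "undirected_forest G"
  shows "saturated I \<Longrightarrow> game_value Dominator I \<le> game_value Staller I"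
    and "saturated I \<Longrightarrow> saturated R \<Longrightarrow> I \<subseteq> R \<Longrightarrow> v \<in> verts G - I \<Longrightarrow> guarded I v R \<Longrightarrow>
      Suc (game_value p R) \<le> game_value p I"
proof (induction "card (verts G - I)" arbitrary: I R v p rule: less_induct)
  case less
  note IH_start = less.hyps(1) and IH_ahead = less.hyps(2)
  \<comment> \<open>\<open>I\<close> is the imagined and \<open>R\<close> the real position. This
    comes first because claim (1) uses it for the same \<open>I\<close>; the induction hypotheses
    concern only fewer unmarked vertices.\<close>
  have ahead: "Suc (game_value p R) \<le> game_value p I"
    if I: "saturated I" and R: "saturated R" "I \<subseteq> R" and v: "v \<in> verts G - I"
      and g: "guarded I v R" for R v p
  proof -
    have unmarked: "\<not> verts G \<subseteq> I" using v by blast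
    have IH: "Suc (game_value q (mark R t)) \<le> game_value q (mark I t)"
      if "t \<in> legal_moves I" "t \<in> legal_moves R" for t q
    proof (rule IH_ahead[OF mark_decreases[OF that(1)] saturated_mark saturated_mark])
      show "mark I t \<subseteq> mark R t" by (rule mark_mono[OF R(2)])
      \<comment> \<open>Every move marking \<open>v\<close> is illegal in \<open>R\<close>, so
        \<open>t\<close> leaves \<open>v\<close> unmarked.\<close>
      show "v \<in> verts G - mark I t"
        using guarded_mark_illegal[OF g I v] that v by (auto simp: legal_moves_def)
      show "guarded (mark I t) v (mark R t)"
        using guarded_mono[OF g subset_mark subset_mark] .
    qed
    show ?thesis
    proof (cases p)
      case Staller
      show ?thesis
      proof (cases "verts G \<subseteq> R")
        case True
        then show ?thesis
          using game_value_Staller_attained[OF unmarked] Staller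
          by (metis game_value_marked Suc_leI zero_less_Suc)
      next
        case False
        obtain t where t: "t \<in> legal_moves R"
          "game_value Staller R = Suc (game_value Dominator (mark R t))"
          using game_value_Staller_attained[OF False] .
        have tI: "t \<in> legal_moves I"
          using t(1) legal_moves_antimono[OF R(2)] by blast
        show ?thesis
          using IH[OF tI t(1), of Dominator] game_value_Staller_ge[OF tI] t(2) Staller by simp
      qed
    next
      case Dominator
      obtain t where t: "t \<in> legal_moves I"
        "game_value Dominator I = Suc (game_value Staller (mark I t))"
        using game_value_Dominator_attained[OF unmarked] .
      show ?thesis
      proof (cases "t \<in> legal_moves R")
        case True
        then show ?thesis
          using IH[OF t(1) True, of Staller] game_value_Dominator_le[OF True] t(2) Dominator by simp
      next
        case False
        \<comment> \<open>Here \<open>t\<close> is wasted: Dominator is to move at \<open>R\<close>,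
          Staller at \<open>mark I t \<subseteq> R\<close>. As \<open>v\<close> lies in
          \<open>R\<close> but not in \<open>I\<close>, claim (1) holds at \<open>R\<close> by
          induction and absorbs the change of turn.\<close>
        have "card (verts G - R) < card (verts G - I)"
          using guarded_imp_mem[OF g v] v R(2) by (intro psubset_card_mono) auto
        then have "game_value Dominator R \<le> game_value Staller R"
          using IH_start R(1) by blast
        also have "mark I t \<subseteq> R"
          using mark_illegal_subset[OF R(2,1) _ False] t(1) by (auto simp: legal_moves_def)
        then have "game_value Staller R \<le> game_value Staller (mark I t)"
          using continuation_principle R(1) by blast
        finally show ?thesis using t(2) Dominator by simp
      qed
    qed
  qed
  {
    case 1
    show ?case
    proof (cases "verts G \<subseteq> I")
      case False
      obtain v x where v: "v \<in> verts G - I" and x: "x \<in> verts G" and g: "guarded I v (mark I x)"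
        using guarded_move_exists[OF assms 1 False] .
      \<comment> \<open>An illegal \<open>x\<close> would give
        \<open>mark I x \<subseteq> I\<close>, although guarding puts \<open>v\<close> in
        \<open>mark I x\<close>.\<close>
      have "x \<in> legal_moves I"
        using mark_illegal_subset[OF subset_refl 1 x] guarded_imp_mem[OF g v] v by blast
      then have "game_value Dominator I \<le> Suc (game_value Staller (mark I x))"
        by (rule game_value_Dominator_le)
      also have "\<dots> \<le> game_value Staller I"
        using ahead[OF 1 saturated_mark subset_mark v g] .
      finally show ?thesis .
    qed (simp add: game_value_marked)
  next
    case 2
    then show ?case by (rule ahead)
  }
qed

end

theorem theorem4p2:
  fixes G :: "('a, 'b) pre_digraph" and A :: "'a set"
  assumes "partially_marked_forest G A"
  shows "graph.game_isolation_number G A \<le> graph.game_isolation_number' G A"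
proof -
  interpret partially_marked_forest G A by (rule assms)
  have "saturated A"
    using no_isolated by (auto simp: isolated_verts_delete_verts saturated_def)
  then show ?thesis
    unfolding game_isolation_number_def game_isolation_number'_def
    using forest_game_values(1)[OF undirected_forest] by blast
qed

end
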